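(* Let $k\ge1$, $f,t:\mathbb{N}\to\mathbb{R}_{\ge0}$. Suppose there is a distributed algorithm $A$ (in the $\mathcal{LOCAL}$ model) that on every $n$-vertex graph with nonnegative edge lengths builds a $k$-spanner with at most $f(n)$ edges in $t(n)$ rounds. Then there is a distributed algorithm that, on any $n$-vertex graph $G$ and for any integer $r\ge1$ known to all nodes, builds with high probability an $r$-fault tolerant $k$-spanner of $G$ with $O(r^3\log n\cdot f(2n/r))$ edges in $O(r^3\log n\cdot t(n))$ rounds.
   Context: The $\mathcal{LOCAL}$ model of distributed computation: the nodes of the graph are processors communicating in synchronous rounds; in each round every node may send a message of unbounded size to each of its neighbors. A subgraph $G'=(V,E')$ of $G=(V,E)$ is a $k$-spanner if $d_{G'}(u,v)\le k\,d_G(u,v)$ for all $u,v\in V$, where $d_H$ is shortest-path distance in $H$. For $F\subseteq V$, $G\setminus F$ denotes $G$ with the vertices of $F$ and incident edges removed. $G'$ is an $r$-fault tolerant $k$-spanner if for every $F\subseteq V$ with $|F|\le r$ and all $u,v\in V\setminus F$, $d_{G'\setminus F}(u,v)\le k\,d_{G\setminus F}(u,v)$. "With high probability" means with probability at least $1-1/n^{C}$ for a constant $C$ that can be made arbitrarily large at the cost of increasing the constants in $O(\cdot)$.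
   Formalization: The functions f and t are additionally assumed nondecreasing and r is at most n (without these the claim can fail, e.g. f(1)=0 with r≥2n); f(2n/r) is read as f of 2n/r rounded up. *)

theory Defs
  imports "HOL-Probability.Probability" "HOL-Library.FSet"
begin

definition wgraph :: "nat set \<Rightarrow> nat set set \<Rightarrow> (nat set \<Rightarrow> real) \<Rightarrow> bool" where
  "wgraph V E w \<longleftrightarrow> finite V \<and>
     (\<forall>e\<in>E. \<exists>u v. e = {u, v} \<and> u \<noteq> v \<and> u \<in> V \<and> v \<in> V) \<and>
     (\<forall>e\<in>E. 0 \<le> w e)"

definition walk :: "nat set set \<Rightarrow> nat list \<Rightarrow> bool" where
  "walk E xs \<longleftrightarrow> xs \<noteq> [] \<and> (\<forall>i. Suc i < length xs \<longrightarrow> {xs ! i, xs ! Suc i} \<in> E)"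

definition walk_len :: "(nat set \<Rightarrow> real) \<Rightarrow> nat list \<Rightarrow> real" where
  "walk_len w xs = (\<Sum>i<length xs - 1. w {xs ! i, xs ! Suc i})"

text \<open>Shortest-path distance d_H(u,v) in the graph with edge set H (infinite if
there is no path).\<close>

definition gdist :: "nat set set \<Rightarrow> (nat set \<Rightarrow> real) \<Rightarrow> nat \<Rightarrow> nat \<Rightarrow> ereal" where
  "gdist H w u v = Inf {ereal (walk_len w xs) | xs. walk H xs \<and> hd xs = u \<and> last xs = v}"

definition del_vertices :: "nat set \<Rightarrow> nat set set \<Rightarrow> nat set set" where
  "del_vertices F E = {e \<in> E. e \<inter> F = {}}"

definition is_spanner ::
  "nat set \<Rightarrow> nat set set \<Rightarrow> (nat set \<Rightarrow> real) \<Rightarrow> real \<Rightarrow> nat set set \<Rightarrow> bool" where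
  "is_spanner V E w k H \<longleftrightarrow> H \<subseteq> E \<and>
     (\<forall>u\<in>V. \<forall>v\<in>V. gdist H w u v \<le> ereal k * gdist E w u v)"

definition is_ft_spanner ::
  "nat set \<Rightarrow> nat set set \<Rightarrow> (nat set \<Rightarrow> real) \<Rightarrow> nat \<Rightarrow> real \<Rightarrow> nat set set \<Rightarrow> bool" where
  "is_ft_spanner V E w r k H \<longleftrightarrow> H \<subseteq> E \<and>
     (\<forall>F. F \<subseteq> V \<longrightarrow> card F \<le> r \<longrightarrow>
        (\<forall>u\<in>V - F. \<forall>v\<in>V - F.
           gdist (del_vertices F H) w u v \<le> ereal k * gdist (del_vertices F E) w u v))"

text \<open>The knowledge of a node. Initially a node knows its ID, the number n of
vertices, the globally known parameter r (0 if none), its incident edges with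
their lengths, and its private random value. In each round every node sends
its whole knowledge to every neighbour (messages have unbounded size, so this
full-information protocol simulates any LOCAL algorithm).\<close>

datatype lstate =
    Init nat nat nat "(nat \<times> real) fset" nat
  | Round lstate "(nat \<times> lstate) fset"

fun know :: "nat set set \<Rightarrow> (nat set \<Rightarrow> real) \<Rightarrow> nat \<Rightarrow> nat \<Rightarrow> (nat \<Rightarrow> nat)
               \<Rightarrow> nat \<Rightarrow> nat \<Rightarrow> lstate" where
  "know E w n r \<rho> 0 v = Init v n r (Abs_fset {(u, w {v, u}) | u. {v, u} \<in> E}) (\<rho> v)"
| "know E w n r \<rho> (Suc i) v =
     Round (know E w n r \<rho> i v) (Abs_fset {(u, know E w n r \<rho> i u) | u. {v, u} \<in> E})"

definition local_output ::
  "nat set set \<Rightarrow> (nat set \<Rightarrow> real) \<Rightarrow> nat \<Rightarrow> nat \<Rightarrow> (nat \<Rightarrow> nat) \<Rightarrow> nat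
     \<Rightarrow> (lstate \<Rightarrow> nat set set) \<Rightarrow> nat set set" where
  "local_output E w n r \<rho> T out = {e \<in> E. \<exists>v\<in>e. e \<in> out (know E w n r \<rho> T v)}"

definition det_spanner_alg ::
  "real \<Rightarrow> (nat \<Rightarrow> real) \<Rightarrow> (nat \<Rightarrow> real) \<Rightarrow> (nat \<Rightarrow> nat) \<Rightarrow> (lstate \<Rightarrow> nat set set) \<Rightarrow> bool" where
  "det_spanner_alg k f t T out \<longleftrightarrow>
     (\<forall>V E w. wgraph V E w \<longrightarrow>
        (let n = card V; H = local_output E w n 0 (\<lambda>_. 0) (T n) out in
          real (T n) \<le> t n \<and> is_spanner V E w k H \<and> real (card H) \<le> f n))"

text \<open>A randomized LOCAL algorithm with known parameter r: it runs T n r rounds;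
each node draws its private random value independently from the distribution
D n r; out maps the final knowledge to the chosen incident edges.
ft_success is the event (over the random values) that the output is an r-fault
tolerant k-spanner with at most the given number of edges.\<close>

definition ft_success ::
  "nat set \<Rightarrow> nat set set \<Rightarrow> (nat set \<Rightarrow> real) \<Rightarrow> nat \<Rightarrow> real \<Rightarrow> real
     \<Rightarrow> nat \<Rightarrow> (lstate \<Rightarrow> nat set set) \<Rightarrow> (nat \<Rightarrow> nat) set" where
  "ft_success V E w r k bound T out =
     {\<rho>. let H = local_output E w (card V) r \<rho> T out in
            is_ft_spanner V E w r k H \<and> real (card H) \<le> bound}"

end

theory Submission
  imports Defs "HOL-Library.Nat_Bijection"
begin

text \<open>Run the given algorithm \<open>A\<close> on \<open>\<alpha> = O(r\<^sup>3 ln n)\<close> random induced subgraphs in parallel, each vertex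
being active with probability \<open>1/(r + 1)\<close>, and return the union of the spanners. A fault set \<open>F\<close> and
two vertices \<open>u, v\<close> outside it are separated by one iteration (\<open>u, v\<close> active, \<open>F\<close> inactive) with
probability \<open>\<Omega>(1/r\<^sup>2)\<close>, so by a union bound every surviving edge is stretched by at most \<open>k\<close>
within some subgraph avoiding \<open>F\<close>. Hoeffding's inequality bounds the number of active vertices by
\<open>2n/r\<close> as long as \<open>n/r\<^sup>2\<close> exceeds a multiple of \<open>ln n\<close>. Otherwise, since a spanner of a star is the whole
star and so \<open>f m \<ge> m - 1\<close>, the edge bound exceeds \<open>n\<^sup>2\<close> and all edges may be kept. The same
happens when \<open>A\<close> uses no communication, because then \<open>f m = \<Omega>(m\<^sup>2)\<close>; in the remaining case
one extra round, in which neighbours learn each other's random bits, is affordable.\<close>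

section \<open>Simulating an algorithm on random induced subgraphs\<close>

primrec vid :: "lstate \<Rightarrow> nat" where
  "vid (Init v n r nb x) = v" | "vid (Round s ms) = vid s"
primrec known_n :: "lstate \<Rightarrow> nat" where
  "known_n (Init v n r nb x) = n" | "known_n (Round s ms) = known_n s"
primrec known_r :: "lstate \<Rightarrow> nat" where
  "known_r (Init v n r nb x) = r" | "known_r (Round s ms) = known_r s"
primrec nbrs :: "lstate \<Rightarrow> (nat \<times> real) fset" where
  "nbrs (Init v n r nb x) = nb" | "nbrs (Round s ms) = nbrs s"
primrec rnd :: "lstate \<Rightarrow> nat" where
  "rnd (Init v n r nb x) = x" | "rnd (Round s ms) = rnd s"
primrec prev :: "lstate \<Rightarrow> lstate" where
  "prev (Init v n r nb x) = Init v n r nb x" | "prev (Round s ms) = s"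
primrec msgs :: "lstate \<Rightarrow> (nat \<times> lstate) fset" where
  "msgs (Init v n r nb x) = {||}" | "msgs (Round s ms) = ms"

text \<open>Activity depends on the random value alone, so a node can evaluate it for a neighbour as
  soon as it has received that neighbour's state.\<close>

definition active_edges :: "(nat \<Rightarrow> bool) \<Rightarrow> (nat \<Rightarrow> nat) \<Rightarrow> nat set set \<Rightarrow> nat set set" where
  "active_edges a \<rho> E = {e \<in> E. \<forall>x\<in>e. a (\<rho> x)}"

text \<open>The first round tells a node which neighbours take part, so a simulated state after
\<open>i\<close> rounds is computed from a real state after \<open>Suc i\<close> rounds.\<close>

primrec simulate :: "(nat \<Rightarrow> bool) \<Rightarrow> nat \<Rightarrow> nat \<Rightarrow> lstate \<Rightarrow> lstate" where
  "simulate a m 0 s = Init (vid s) m 0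
     (ffilter (\<lambda>(u, _). a (rnd s) \<and> (\<exists>s'. (u, s') |\<in>| msgs s \<and> a (rnd s'))) (nbrs s)) 0"
| "simulate a m (Suc i) s = Round (simulate a m i (prev s))
     ((\<lambda>(u, s'). (u, simulate a m i s')) |`| ffilter (\<lambda>(u, s'). a (rnd s) \<and> a (rnd s')) (msgs s))"

text \<open>The edges visible from a state. In a simulated state these are active edges only;
  intersecting with them keeps \<open>out\<close> from selecting a real edge that is absent from the
  simulated graph.\<close>

definition incident :: "lstate \<Rightarrow> nat set set" where
  "incident s = {{vid s, u} | u x. (u, x) |\<in>| nbrs s}"

lemma know_simps [simp]:
  "vid (know E w n r \<rho> i v) = v"
  "known_n (know E w n r \<rho> i v) = n"
  "known_r (know E w n r \<rho> i v) = r"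
  "rnd (know E w n r \<rho> i v) = \<rho> v"
  "nbrs (know E w n r \<rho> i v) = Abs_fset {(u, w {v, u}) | u. {v, u} \<in> E}"
  by (induction i) auto

lemma finite_neighbours:
  assumes "finite E" shows "finite {u. {v, u} \<in> E}"
proof -
  have "inj (\<lambda>u. {v, u})" by (auto simp: inj_on_def doubleton_eq_iff)
  from finite_vimageI[OF assms this] show ?thesis by (simp add: vimage_def)
qed

text \<open>\<open>Abs_fset\<close> is meaningful only on finite sets; here it is applied to an
  image of the finite neighbourhood of \<open>v\<close>.\<close>

lemma fmember_neighbours:
  assumes "finite E"
  shows "p |\<in>| Abs_fset {(u, g u) | u. {v, u} \<in> E} \<longleftrightarrow> {v, fst p} \<in> E \<and> snd p = g (fst p)"
proof -
  have "{(u, g u) | u. {v, u} \<in> E} = (\<lambda>u. (u, g u)) ` {u. {v, u} \<in> E}" by auto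
  then have "finite {(u, g u) | u. {v, u} \<in> E}"
    using finite_neighbours[OF assms] by simp
  then show ?thesis by (cases p) (auto simp: Abs_fset_inverse)
qed

text \<open>The recursion preserves the delay of one round: a real state after
  \<open>Suc (Suc i)\<close> rounds contains the states of the node and of its neighbours after
  \<open>Suc i\<close> rounds, to which the induction hypothesis applies. An inactive node has all
  its edges filtered out and simulates an isolated vertex.\<close>

lemma simulate_know:
  assumes "finite E"
  shows "simulate a m i (know E w n r \<rho> (Suc i) v) = know (active_edges a \<rho> E) w m 0 (\<lambda>_. 0) i v"
proof -
  have fin: "finite (active_edges a \<rho> E)" using assms by (simp add: active_edges_def)
  have edge: "{x, y} \<in> active_edges a \<rho> E \<longleftrightarrow> {x, y} \<in> E \<and> a (\<rho> x) \<and> a (\<rho> y)" for x y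
    by (auto simp: active_edges_def)
  show ?thesis
  proof (induction i arbitrary: v)
    case 0
    have "ffilter (\<lambda>(u, _). a (\<rho> v) \<and> (\<exists>s'. (u, s') |\<in>| Abs_fset {(u, know E w n r \<rho> 0 u) | u. {v, u} \<in> E} \<and> a (rnd s')))
          (Abs_fset {(u, w {v, u}) | u. {v, u} \<in> E}) =
        Abs_fset {(u, w {v, u}) | u. {v, u} \<in> active_edges a \<rho> E}" (is "?L = ?R")
    proof (rule fset_eqI)
      fix p :: "nat \<times> real"
      show "p |\<in>| ?L \<longleftrightarrow> p |\<in>| ?R"
        unfolding fmember_neighbours[OF fin] unfolding edge
        by (cases p) (auto simp: fmember_neighbours[OF assms] simp del: know.simps)
    qed
    then show ?case by simp
  next
    case (Suc i)
    have "(\<lambda>(u, s'). (u, simulate a m i s')) |`|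
        ffilter (\<lambda>(u, s'). a (\<rho> v) \<and> a (rnd s'))
          (Abs_fset {(u, know E w n r \<rho> (Suc i) u) | u. {v, u} \<in> E}) =
        Abs_fset {(u, know (active_edges a \<rho> E) w m 0 (\<lambda>_. 0) i u) | u. {v, u} \<in> active_edges a \<rho> E}"
      (is "?f |`| ?L = ?R")
    proof (rule fset_eqI)
      fix p :: "nat \<times> lstate"
      have "p |\<in>| ?f |`| ?L \<longleftrightarrow> (\<exists>u s'. (u, s') |\<in>| ?L \<and> p = (u, simulate a m i s'))"
        by force
      also have "\<dots> \<longleftrightarrow> (\<exists>u. {v, u} \<in> E \<and> a (\<rho> v) \<and> a (\<rho> u) \<and> p = (u, simulate a m i (know E w n r \<rho> (Suc i) u)))"
        by (auto simp: fmember_neighbours[OF assms] simp del: know.simps)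
      also have "\<dots> \<longleftrightarrow> p |\<in>| ?R"
        unfolding fmember_neighbours[OF fin] unfolding edge Suc.IH by (cases p) auto
      finally show "p |\<in>| ?f |`| ?L \<longleftrightarrow> p |\<in>| ?R" .
    qed
    moreover have "simulate a m i (know E w n r \<rho> (Suc i) v) = know (active_edges a \<rho> E) w m 0 (\<lambda>_. 0) i v"
      by (rule Suc.IH)
    ultimately show ?case
      unfolding simulate.simps know_simps know.simps(2)[of E w n r \<rho> "Suc i" v] msgs.simps prev.simps
        know.simps(2)[of _ _ _ _ _ i v] rnd.simps
      by (simp del: know.simps)
  qed
qed

lemma edge_in_incident_iff:
  assumes "finite E" "\<And>e. e \<in> E \<Longrightarrow> \<exists>u v. e = {u, v}" "E' \<subseteq> E" "e \<in> E" "v \<in> e"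
  shows "e \<in> incident (know E' w n r \<rho> i v) \<longleftrightarrow> e \<in> E'"
proof -
  obtain u where u: "e = {v, u}" using assms by fastforce
  have "finite E'" using assms finite_subset by auto
  then show ?thesis
    by (auto simp: incident_def fmember_neighbours u doubleton_eq_iff)
qed

text \<open>Messages are unbounded, so all \<alpha> iterations are read off one and the same final
  state and share its rounds.\<close>

definition simulate_out ::
  "nat \<Rightarrow> (nat \<Rightarrow> nat \<Rightarrow> bool) \<Rightarrow> nat \<Rightarrow> nat \<Rightarrow> (lstate \<Rightarrow> nat set set) \<Rightarrow> lstate \<Rightarrow> nat set set" where
  "simulate_out \<alpha> a m T out s =
     (\<Union>j<\<alpha>. out (simulate (a j) m T s) \<inter> incident (simulate (a j) m T s))"

lemma local_output_simulate_out:
  assumes "finite E" "\<And>e. e \<in> E \<Longrightarrow> \<exists>u v. e = {u, v}"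
    and out': "\<And>v. out' (know E w n r \<rho> (Suc T) v) = simulate_out \<alpha> a m T out (know E w n r \<rho> (Suc T) v)"
  shows "local_output E w n r \<rho> (Suc T) out' =
     (\<Union>j<\<alpha>. local_output (active_edges (a j) \<rho> E) w m 0 (\<lambda>_. 0) T out)"
proof -
  have sub: "active_edges (a j) \<rho> E \<subseteq> E" for j by (auto simp: active_edges_def)
  define K where "K j v = know (active_edges (a j) \<rho> E) w m 0 (\<lambda>_. 0) T v" for j v
  show ?thesis
  proof (rule set_eqI)
    fix e
    have "e \<in> local_output E w n r \<rho> (Suc T) out' \<longleftrightarrow>
        (\<exists>v\<in>e. \<exists>j<\<alpha>. e \<in> E \<and> e \<in> out (K j v) \<and> e \<in> incident (K j v))"
      unfolding local_output_def out' simulate_out_def simulate_know[OF assms(1)] K_def by auto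
    also have "\<dots> \<longleftrightarrow> (\<exists>v\<in>e. \<exists>j<\<alpha>. e \<in> E \<and> e \<in> out (K j v) \<and> e \<in> active_edges (a j) \<rho> E)"
      using edge_in_incident_iff[OF assms(1,2) sub] unfolding K_def by (metis (no_types, lifting))
    also have "\<dots> \<longleftrightarrow> e \<in> (\<Union>j<\<alpha>. local_output (active_edges (a j) \<rho> E) w m 0 (\<lambda>_. 0) T out)"
      using sub unfolding local_output_def K_def by auto
    finally show "e \<in> local_output E w n r \<rho> (Suc T) out' \<longleftrightarrow>
        e \<in> (\<Union>j<\<alpha>. local_output (active_edges (a j) \<rho> E) w m 0 (\<lambda>_. 0) T out)" .
  qed
qed

section \<open>Spanners from local stretch, and lower bounds on their size\<close>

lemma walk_Nil [simp]: "\<not> walk H []"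
  by (simp add: walk_def)

lemma walk_single [simp]: "walk H [x]"
  by (simp add: walk_def)

lemma walk_Cons_Cons [simp]: "walk H (x # y # zs) \<longleftrightarrow> {x, y} \<in> H \<and> walk H (y # zs)"
  unfolding walk_def by (auto simp: nth_Cons split: nat.splits)

lemma walk_len_single [simp]: "walk_len w [x] = 0"
  by (simp add: walk_len_def)

lemma walk_len_Cons_Cons [simp]: "walk_len w (x # y # zs) = w {x, y} + walk_len w (y # zs)"
  by (simp add: walk_len_def sum.lessThan_Suc_shift del: sum.lessThan_Suc)

lemma walk_append: "walk H (xs @ [y]) \<Longrightarrow> walk H (y # ys) \<Longrightarrow> walk H (xs @ y # ys)"
proof (induction xs)
  case (Cons x xs)
  then show ?case by (cases xs) auto
qed simp

lemma walk_len_append: "walk_len w (xs @ y # ys) = walk_len w (xs @ [y]) + walk_len w (y # ys)"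
proof (induction xs)
  case (Cons x xs)
  then show ?case by (cases xs) auto
qed simp

lemma walk_len_nonneg:
  assumes "\<forall>e\<in>H. 0 \<le> w e" "walk H xs" shows "0 \<le> walk_len w xs"
  using assms(2) by (induction xs rule: induct_list012) (use assms(1) in auto)

lemma gdist_le_walk_len: "walk H xs \<Longrightarrow> gdist H w (hd xs) (last xs) \<le> ereal (walk_len w xs)"
  unfolding gdist_def by (rule Inf_lower) blast

lemma gdist_nonneg:
  assumes "\<forall>e\<in>H. 0 \<le> w e" shows "0 \<le> gdist H w u v"
  unfolding gdist_def by (rule Inf_greatest) (auto simp: walk_len_nonneg[OF assms])

lemma gdist_antimono: "H \<subseteq> H' \<Longrightarrow> gdist H' w u v \<le> gdist H w u v"
  unfolding gdist_def by (rule Inf_superset_mono) (auto simp: walk_def)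

lemma gdist_refl: "gdist H w u u \<le> ereal 0"
  using gdist_le_walk_len[of H "[u]" w] by simp

lemma gdist_edge: "{u, v} \<in> H \<Longrightarrow> gdist H w u v \<le> ereal (w {u, v})"
  using gdist_le_walk_len[of H "[u, v]" w] by simp

lemma gdist_triangle:
  assumes w: "\<forall>e\<in>H. 0 \<le> w e"
  shows "gdist H w a c \<le> gdist H w a b + gdist H w b c"
proof (cases "gdist H w b c = \<infinity>")
  case True
  then show ?thesis using gdist_nonneg[OF w, of a b] by auto
next
  case False
  \<comment> \<open>A finite second distance may be subtracted in \<open>ereal\<close>, so the two
    infima can be taken one after the other.\<close>
  then have fin: "\<bar>gdist H w b c\<bar> \<noteq> \<infinity>"
    using gdist_nonneg[OF w, of b c] by auto
  have walks: "gdist H w a c \<le> ereal (walk_len w p) + ereal (walk_len w q)"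
    if pq: "walk H p" "hd p = a" "last p = b" "walk H q" "hd q = b" "last q = c" for p q
  proof -
    obtain p' where p: "p = p' @ [b]" using pq by (cases p rule: rev_cases) auto
    obtain q' where q: "q = b # q'" using pq by (cases q) auto
    have "walk H (p' @ b # q')" using that walk_append p q by auto
    moreover have "hd (p' @ b # q') = a" using that p by (cases p') auto
    moreover have "last (p' @ b # q') = c" using that q by simp
    moreover have "walk_len w (p' @ b # q') = walk_len w p + walk_len w q"
      unfolding p q by (rule walk_len_append)
    ultimately show ?thesis
      using gdist_le_walk_len[of H "p' @ b # q'" w] by (simp del: last_append hd_append)
  qed
  have "gdist H w a c - ereal (walk_len w p) \<le> gdist H w b c"
    if "walk H p" "hd p = a" "last p = b" for p
    unfolding gdist_def[of H w b c]
  proof (rule Inf_greatest, clarify)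
    fix q assume "walk H q" "b = hd q" "c = last q"
    then show "gdist H w a (last q) - ereal (walk_len w p) \<le> ereal (walk_len w q)"
      using walks[OF that, of q] by (simp add: ereal_minus_le add.commute)
  qed
  then have "gdist H w a c - gdist H w b c \<le> ereal (walk_len w p)"
    if "walk H p" "hd p = a" "last p = b" for p
    using that fin by (simp add: ereal_minus_le add.commute)
  then have "gdist H w a c - gdist H w b c \<le> gdist H w a b"
    unfolding gdist_def[of H w a b] by (intro Inf_greatest) auto
  then show ?thesis using fin by (simp add: ereal_minus_le)
qed

text \<open>Stretch needs checking on single edges only: the triangle inequality adds the bounds up
  along a walk of \<open>E\<close>, and the factor \<open>k > 0\<close> commutes with the infimum
  over walks.\<close>

lemma gdist_stretch:
  assumes w: "\<forall>e\<in>H. 0 \<le> w e" and k: "k > 0"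
    and edge: "\<And>x y. {x, y} \<in> E \<Longrightarrow> gdist H w x y \<le> ereal (k * w {x, y})"
  shows "gdist H w u v \<le> ereal k * gdist E w u v"
proof -
  have walk: "gdist H w (hd xs) (last xs) \<le> ereal (k * walk_len w xs)" if "walk E xs" for xs
    using that
  proof (induction xs rule: induct_list012)
    case (3 x y zs)
    then have "gdist H w x (last (y # zs)) \<le> ereal (k * w {x, y}) + ereal (k * walk_len w (y # zs))"
      using edge[of x y]
      by (intro order_trans[OF gdist_triangle[OF w, of x "last (y # zs)" y]] add_mono)
         (simp_all del: last.simps)
    then show ?case by (simp add: distrib_left)
  qed (simp_all add: gdist_refl)
  show ?thesis
    unfolding gdist_def[of E w u v] ereal_Inf_cmult[OF k, symmetric]
    by (rule Inf_greatest) (use walk in auto)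
qed

text \<open>An edge surviving the faults \<open>F\<close> lies inside some \<open>S j\<close> that
  avoids \<open>F\<close>. All edges of \<open>H j\<close> lie inside \<open>S j\<close>, so they
  survive too and stretch that edge by at most \<open>k\<close>. The vertex sets \<open>W j\<close>
  are kept separate from \<open>S j\<close> to leave room for padding.\<close>

lemma is_ft_spanner_UN:
  assumes G: "wgraph V E w" and k: "k > 0"
    and sp: "\<And>j. j < \<alpha> \<Longrightarrow> is_spanner (W j) {e \<in> E. e \<subseteq> S j} w k (H j)"
    and W: "\<And>j. j < \<alpha> \<Longrightarrow> V \<inter> S j \<subseteq> W j"
    and hit: "\<And>F u v. F \<subseteq> V \<Longrightarrow> card F \<le> r \<Longrightarrow> u \<in> V - F \<Longrightarrow> v \<in> V - F \<Longrightarrow> u \<noteq> v \<Longrightarrow>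
       \<exists>j<\<alpha>. u \<in> S j \<and> v \<in> S j \<and> S j \<inter> F = {}"
  shows "is_ft_spanner V E w r k (\<Union>j<\<alpha>. H j)"
proof -
  have w: "\<forall>e\<in>E. 0 \<le> w e" using G by (simp add: wgraph_def)
  have H: "H j \<subseteq> {e \<in> E. e \<subseteq> S j}" if "j < \<alpha>" for j
    using sp[OF that] by (simp add: is_spanner_def)
  have "gdist (del_vertices F (\<Union>j<\<alpha>. H j)) w u v \<le> ereal k * gdist (del_vertices F E) w u v"
    if F: "F \<subseteq> V" "card F \<le> r" for F u v
  proof (rule gdist_stretch[OF _ k])
    show "\<forall>e\<in>del_vertices F (\<Union>j<\<alpha>. H j). 0 \<le> w e"
      using H w by (auto simp: del_vertices_def)
  next
    fix x y assume xy: "{x, y} \<in> del_vertices F E"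
    then have mem: "{x, y} \<in> E" "x \<notin> F" "y \<notin> F" by (auto simp: del_vertices_def)
    then have "x \<in> V" "y \<in> V" "x \<noteq> y" using G unfolding wgraph_def by (auto simp: doubleton_eq_iff)
    then obtain j where j: "j < \<alpha>" "x \<in> S j" "y \<in> S j" "S j \<inter> F = {}"
      using hit[OF F, of x y] mem by auto
    have "H j \<subseteq> del_vertices F (\<Union>j<\<alpha>. H j)"
      using H[OF j(1)] j(1,4) by (auto simp: del_vertices_def)
    then have "gdist (del_vertices F (\<Union>j<\<alpha>. H j)) w x y \<le> gdist (H j) w x y"
      by (rule gdist_antimono)
    also have "\<dots> \<le> ereal k * gdist {e \<in> E. e \<subseteq> S j} w x y"
    proof -
      have "x \<in> W j" "y \<in> W j" using W[OF j(1)] \<open>x \<in> V\<close> \<open>y \<in> V\<close> j by auto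
      then show ?thesis using sp[OF j(1)] by (simp add: is_spanner_def)
    qed
    also have "\<dots> \<le> ereal k * ereal (w {x, y})"
      using k mem j by (intro ereal_mult_left_mono gdist_edge) auto
    finally show "gdist (del_vertices F (\<Union>j<\<alpha>. H j)) w x y \<le> ereal (k * w {x, y})" by simp
  qed
  moreover have "(\<Union>j<\<alpha>. H j) \<subseteq> E" using H by blast
  ultimately show ?thesis by (simp add: is_ft_spanner_def)
qed

lemma is_ft_spanner_self:
  assumes "wgraph V E w" "k \<ge> 1"
  shows "is_ft_spanner V E w r k E"
proof -
  have w: "\<forall>e\<in>E. 0 \<le> w e" using assms(1) by (simp add: wgraph_def)
  have "gdist (del_vertices F E) w u v \<le> ereal k * gdist (del_vertices F E) w u v" for F u v
  proof (rule gdist_stretch)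
    fix x y assume xy: "{x, y} \<in> del_vertices F E"
    then have "w {x, y} \<le> k * w {x, y}"
      using w assms(2) by (intro mult_le_cancel_right1[THEN iffD2]) (auto simp: del_vertices_def)
    then show "gdist (del_vertices F E) w x y \<le> ereal (k * w {x, y})"
      using gdist_edge[OF xy, of w] by (meson ereal_less_eq(3) order_trans)
  qed (use w assms(2) in \<open>auto simp: del_vertices_def\<close>)
  then show ?thesis by (simp add: is_ft_spanner_def)
qed

text \<open>\<open>{u, v}\<close> is the only edge leaving the cut \<open>S\<close>. Without it no
  walk of \<open>H\<close> leaves \<open>S\<close>, which makes the distance from \<open>u\<close>
  to \<open>v\<close> infinite in \<open>H\<close> although it is finite in
  \<open>E\<close>.\<close>

lemma bridge_in_spanner:
  assumes sp: "is_spanner V E w k H" and k: "k \<ge> 0" and uv: "u \<in> V" "v \<in> V" "{u, v} \<in> E"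
    and S: "u \<in> S" "v \<notin> S" "\<And>e. e \<in> E \<Longrightarrow> e \<noteq> {u, v} \<Longrightarrow> e \<inter> S = {} \<or> e \<subseteq> S"
  shows "{u, v} \<in> H"
proof (rule ccontr)
  assume nH: "{u, v} \<notin> H"
  have HE: "H \<subseteq> E" using sp by (simp add: is_spanner_def)
  have "last xs \<in> S" if "walk H xs" "hd xs \<in> S" for xs
    using that
  proof (induction xs rule: induct_list012)
    case (3 x y zs)
    then have "{x, y} \<in> E" "{x, y} \<noteq> {u, v}" using HE nH by auto
    with S(3)[of "{x, y}"] 3 show ?case by auto
  qed auto
  then have empty: "{ereal (walk_len w xs) | xs. walk H xs \<and> hd xs = u \<and> last xs = v} = {}"
    using S by auto
  have "\<infinity> = gdist H w u v" unfolding gdist_def empty by (simp add: top_ereal_def)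
  also have "gdist H w u v \<le> ereal k * gdist E w u v"
    using sp uv by (simp add: is_spanner_def)
  also have "\<dots> \<le> ereal k * ereal (w {u, v})"
    using k by (intro ereal_mult_left_mono gdist_edge uv) auto
  finally show False by simp
qed

section \<open>Lower bounds on \<open>f\<close> from graphs with many forced edges\<close>

lemma det_spanner_algD:
  assumes "det_spanner_alg k f t T out" "wgraph V E w" "card V = m"
  shows "real (T m) \<le> t m" "is_spanner V E w k (local_output E w m 0 (\<lambda>_. 0) (T m) out)"
    "real (card (local_output E w m 0 (\<lambda>_. 0) (T m) out)) \<le> f m"
  using assms unfolding det_spanner_alg_def Let_def by blast+

text \<open>The round bound is guaranteed only through an input graph of the right order; the
  edgeless one serves.\<close>

lemma det_spanner_alg_rounds:
  assumes "det_spanner_alg k f t T out"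
  shows "real (T m) \<le> t m"
  using det_spanner_algD(1)[OF assms, of "{..<m}" "{}" "\<lambda>_. 0" m] by (simp add: wgraph_def)

lemma det_spanner_alg_edges_ge:
  assumes alg: "det_spanner_alg k f t T out" and k: "k \<ge> 0"
  shows "real m - 1 \<le> f m"
proof (cases "m = 0")
  case True
  have "0 \<le> f 0"
    using det_spanner_algD(3)[OF alg, of "{}" "{}" "\<lambda>_. 0" 0] by (simp add: wgraph_def local_output_def)
  then show ?thesis using True by simp
next
  case False
  define E :: "nat set set" where "E = (\<lambda>i. {0, i}) ` {1..<m}"
  define H where "H = local_output E (\<lambda>_. 0) m 0 (\<lambda>_. 0) (T m) out"
  have G: "wgraph {..<m} E (\<lambda>_. 0)"
    unfolding wgraph_def E_def using False by fastforce
  have sp: "is_spanner {..<m} E (\<lambda>_. 0) k H" and H: "real (card H) \<le> f m"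
    using det_spanner_algD(2,3)[OF alg G] by (auto simp: H_def)
  \<comment> \<open>The cut separates the leaf \<open>i\<close> from all other vertices.\<close>
  have "{0, i} \<in> H" if "1 \<le> i" "i < m" for i
    by (rule bridge_in_spanner[OF sp k, where S = "{..<m} - {i}"]) (use that in \<open>auto simp: E_def\<close>)
  then have "E \<subseteq> H" by (auto simp: E_def)
  moreover have "H \<subseteq> E" using sp by (simp add: is_spanner_def)
  ultimately have "H = E" by simp
  moreover have "card E = m - 1"
    unfolding E_def by (subst card_image) (auto simp: inj_on_def doubleton_eq_iff)
  ultimately show ?thesis using H False by simp
qed

text \<open>Without communication both endpoints of an edge \<open>{x, y}\<close> of a complete bipartite graph see
the same as in the double star formed by the edges at \<open>x\<close> or \<open>y\<close>, where \<open>{x, y}\<close> is a bridge.\<close>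

lemma det_spanner_alg_edges_ge_if_0_rounds:
  assumes alg: "det_spanner_alg k f t T out" and k: "k \<ge> 0" and T: "T m = 0" and a: "a \<le> m"
  shows "real (a * (m - a)) \<le> f m"
proof -
  define E where "E = (\<lambda>(x, y). {x, y}) ` ({..<a} \<times> {a..<m})"
  define H where "H E' = local_output E' (\<lambda>_. 0) m 0 (\<lambda>_. 0) (T m) out" for E'
  have G: "wgraph {..<m} E (\<lambda>_. 0)"
    unfolding wgraph_def E_def using a by fastforce
  have "{x, y} \<in> H E" if xy: "x < a" "a \<le> y" "y < m" for x y
  proof -
    define E' where "E' = {e \<in> E. x \<in> e \<or> y \<in> e}"
    have G': "wgraph {..<m} E' (\<lambda>_. 0)"
      using G by (auto simp: wgraph_def E'_def)
    have sp: "is_spanner {..<m} E' (\<lambda>_. 0) k (H E')"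
      using det_spanner_algD(2)[OF alg G'] by (simp add: H_def)
    have E: "{x, y} \<in> E" using xy by (auto simp: E_def)
    have "{x, y} \<in> H E'"
    \<comment> \<open>The cut consists of \<open>x\<close> and every right-hand vertex except
      \<open>y\<close>: the other edges at \<open>x\<close> stay inside it, and the other edges at
      \<open>y\<close> avoid it.\<close>
    proof (rule bridge_in_spanner[OF sp k])
      fix e assume "e \<in> E'" "e \<noteq> {x, y}"
      then show "e \<inter> insert x ({a..<m} - {y}) = {} \<or> e \<subseteq> insert x ({a..<m} - {y})"
        using xy by (auto simp: E'_def E_def)
    qed (use xy E in \<open>auto simp: E'_def\<close>)
    \<comment> \<open>With zero rounds the output at \<open>x\<close> and \<open>y\<close> depends
      only on their incident edges, which \<open>E\<close> and \<open>E'\<close> share.\<close>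
    moreover have "{z, u} \<in> E' \<longleftrightarrow> {z, u} \<in> E" if "z \<in> {x, y}" for z u
      using that by (auto simp: E'_def)
    then have "know E' (\<lambda>_. 0) m 0 (\<lambda>_. 0) 0 z = know E (\<lambda>_. 0) m 0 (\<lambda>_. 0) 0 z" if "z \<in> {x, y}" for z
      using that by simp
    ultimately show ?thesis
      using E unfolding H_def local_output_def T by auto
  qed
  then have "E \<subseteq> H E" by (auto simp: E_def)
  then have "H E = E" by (auto simp: H_def local_output_def)
  moreover have "inj_on (\<lambda>(x, y). {x, y}) ({..<a} \<times> {a..<m})"
    by (auto simp: inj_on_def doubleton_eq_iff)
  then have "card E = a * (m - a)"
    unfolding E_def by (subst card_image) auto
  ultimately show ?thesis
    using det_spanner_algD(3)[OF alg G] by (simp add: H_def)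
qed

lemma wgraph_card_edges_le:
  assumes "wgraph V E w" shows "card E \<le> card V * card V"
proof -
  have "finite V" using assms by (simp add: wgraph_def)
  moreover have "E \<subseteq> (\<lambda>(u, v). {u, v}) ` (V \<times> V)" using assms unfolding wgraph_def by fast
  ultimately show ?thesis by (metis card_cartesian_product finite_cartesian_product surj_card_le)
qed

lemma wgraph_finite_edges:
  assumes "wgraph V E w" shows "finite E"
  using assms unfolding wgraph_def by (intro finite_subset[of E "Pow V"]) auto

section \<open>Independent coin flips packed into one random number\<close>

text \<open>Drawing a matrix of independent entries row by row or column by column gives the same
  distribution: both point masses are the same double product.\<close>

lemma Pi_pmf_swap:
  assumes A: "finite A" and B: "finite B"
  shows "map_pmf (\<lambda>h j x. h x j) (Pi_pmf A (\<lambda>_. d) (\<lambda>x. Pi_pmf B d (p x))) =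
    Pi_pmf B (\<lambda>_. d) (\<lambda>j. Pi_pmf A d (\<lambda>x. p x j))" (is "map_pmf ?swap ?M = ?N")
proof (rule pmf_eqI)
  fix g :: "'b \<Rightarrow> 'a \<Rightarrow> 'c"
  have "inj ?swap" by (auto simp: inj_on_def fun_eq_iff)
  then have "pmf (map_pmf ?swap ?M) (?swap (\<lambda>x j. g j x)) = pmf ?M (\<lambda>x j. g j x)"
    by (rule pmf_map_inj')
  also have "\<dots> = pmf ?N g"
  proof (cases "(\<forall>x j. x \<notin> A \<or> j \<notin> B \<longrightarrow> g j x = d)")
    case True
    have "pmf ?M (\<lambda>x j. g j x) = (\<Prod>x\<in>A. pmf (Pi_pmf B d (p x)) (\<lambda>j. g j x))"
      using True A by (intro pmf_Pi') (auto simp: fun_eq_iff)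
    also have "\<dots> = (\<Prod>x\<in>A. \<Prod>j\<in>B. pmf (p x j) (g j x))"
      using True B by (intro prod.cong refl pmf_Pi') auto
    also have "\<dots> = (\<Prod>j\<in>B. \<Prod>x\<in>A. pmf (p x j) (g j x))"
      by (rule prod.swap)
    also have "\<dots> = (\<Prod>j\<in>B. pmf (Pi_pmf A d (\<lambda>x. p x j)) (g j))"
      using True A by (intro prod.cong refl pmf_Pi'[symmetric]) auto
    also have "\<dots> = pmf ?N g"
      using True B by (intro pmf_Pi'[symmetric]) (auto simp: fun_eq_iff)
    finally show ?thesis .
  next
    case False
    \<comment> \<open>Off the support both masses vanish, either because an outer argument has a
      non-default value or because one inner factor is zero.\<close>
    then consider x j where "x \<notin> A" "g j x \<noteq> d" | x j where "x \<in> A" "j \<notin> B" "g j x \<noteq> d" by blast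
    then show ?thesis
    proof cases
      case 1
      have "pmf ?M (\<lambda>x j. g j x) = 0"
        using 1 A by (intro pmf_Pi_outside) (auto simp: fun_eq_iff)
      moreover have "pmf ?N g = 0"
      proof (cases "j \<in> B")
        case True
        have "pmf (Pi_pmf A d (\<lambda>x. p x j)) (g j) = 0" using 1 A by (intro pmf_Pi_outside) auto
        then show ?thesis using True B by (auto simp: pmf_Pi intro!: prod_zero)
      next
        case False
        then show ?thesis using 1 B by (intro pmf_Pi_outside) (auto simp: fun_eq_iff)
      qed
      ultimately show ?thesis by simp
    next
      case 2
      have "pmf (Pi_pmf B d (p x)) (\<lambda>j. g j x) = 0" using 2 B by (intro pmf_Pi_outside) auto
      then have "pmf ?M (\<lambda>x j. g j x) = 0" using 2 A by (auto simp: pmf_Pi intro!: prod_zero)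
      moreover have "pmf ?N g = 0" using 2 B by (intro pmf_Pi_outside) (auto simp: fun_eq_iff)
      ultimately show ?thesis by simp
    qed
  qed
  finally show "pmf (map_pmf ?swap ?M) g = pmf ?N g" by simp
qed

lemma prob_all_Pi_pmf:
  assumes "finite A"
  shows "measure_pmf.prob (Pi_pmf A d p) {h. \<forall>x\<in>A. h x \<in> B x} = (\<Prod>x\<in>A. measure_pmf.prob (p x) (B x))"
  using measure_Pi_pmf_Pi[OF assms, of d p B] by (simp add: Pi_def Ball_def)

lemma prob_bernoulli_pmf:
  assumes "0 \<le> p" "p \<le> 1"
  shows "measure_pmf.prob (bernoulli_pmf p) {True} = p" "measure_pmf.prob (bernoulli_pmf p) {False} = 1 - p"
  using assms by (simp_all add: measure_pmf_single)

text \<open>A node has a single natural number as its private randomness. Its binary digit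
  \<open>j\<close> tells whether the node takes part in iteration \<open>j\<close>.\<close>

definition coin_code :: "nat \<Rightarrow> real \<Rightarrow> nat pmf" where
  "coin_code \<alpha> p =
     map_pmf (\<lambda>b. set_encode {j. j < \<alpha> \<and> b j}) (Pi_pmf {..<\<alpha>} False (\<lambda>_. bernoulli_pmf p))"

text \<open>Passing from one bit string per node to one activity pattern per iteration exhibits the
  iterations as independent and identically distributed.\<close>

lemma Pi_pmf_coin_code:
  assumes V: "finite V"
  shows "map_pmf (\<lambda>\<rho> j x. j \<in> set_decode (\<rho> x)) (Pi_pmf V 0 (\<lambda>_. coin_code \<alpha> p)) =
    Pi_pmf {..<\<alpha>} (\<lambda>_. False) (\<lambda>_. Pi_pmf V False (\<lambda>_. bernoulli_pmf p))"
proof -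
  let ?M = "Pi_pmf V (\<lambda>_. False) (\<lambda>_. Pi_pmf {..<\<alpha>} False (\<lambda>_. bernoulli_pmf p))"
  have "map_pmf (\<lambda>\<rho> j x. j \<in> set_decode (\<rho> x)) (Pi_pmf V 0 (\<lambda>_. coin_code \<alpha> p)) =
      map_pmf (\<lambda>h j x. j < \<alpha> \<and> h x j) ?M"
    unfolding coin_code_def using V
    by (subst Pi_pmf_map[where dflt = "\<lambda>_. False"]) (simp_all add: map_pmf_comp o_def)
  also have "\<dots> = map_pmf (\<lambda>h j x. h x j) ?M"
  proof (rule map_pmf_cong[OF refl])
    fix h assume "h \<in> set_pmf ?M"
    then have h: "h \<in> PiE_dflt V (\<lambda>_. False) (\<lambda>_. set_pmf (Pi_pmf {..<\<alpha>} False (\<lambda>_. bernoulli_pmf p)))"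
      using set_Pi_pmf_subset'[OF V, of "\<lambda>_. False" "\<lambda>_. Pi_pmf {..<\<alpha>} False (\<lambda>_. bernoulli_pmf p)"]
      by (auto simp: o_def)
    \<comment> \<open>Decoding leaves a guard \<open>j < \<alpha>\<close>. On the support it is
      implied, since flips beyond \<alpha> have the default value \<open>False\<close>.\<close>
    have "\<not> h x j" if "j \<ge> \<alpha>" for x j
    proof (cases "x \<in> V")
      case True
      then have "h x \<in> set_pmf (Pi_pmf {..<\<alpha>} False (\<lambda>_. bernoulli_pmf p))"
        using h by (auto simp: PiE_dflt_def)
      then show ?thesis using that set_Pi_pmf_subset[of "{..<\<alpha>}" False] by fastforce
    qed (use h in \<open>auto simp: PiE_dflt_def\<close>)
    then show "(\<lambda>j x. j < \<alpha> \<and> h x j) = (\<lambda>j x. h x j)"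
      by (auto simp: fun_eq_iff not_less[symmetric])
  qed
  also have "\<dots> = Pi_pmf {..<\<alpha>} (\<lambda>_. False) (\<lambda>_. Pi_pmf V False (\<lambda>_. bernoulli_pmf p))"
    using Pi_pmf_swap[OF V, of "{..<\<alpha>}"] by simp
  finally show ?thesis .
qed

lemma prob_coin_code:
  assumes "finite V"
  shows "measure_pmf.prob (Pi_pmf V 0 (\<lambda>_. coin_code \<alpha> p)) {\<rho>. P (\<lambda>j x. j \<in> set_decode (\<rho> x))} =
    measure_pmf.prob (Pi_pmf {..<\<alpha>} (\<lambda>_. False) (\<lambda>_. Pi_pmf V False (\<lambda>_. bernoulli_pmf p))) {g. P g}"
  unfolding Pi_pmf_coin_code[OF assms, symmetric] by (simp add: vimage_def)

text \<open>One iteration separates \<open>u, v\<close> from \<open>F\<close> with probability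
  \<open>p\<^sup>2 * (1 - p) ^ card F\<close>, and the \<alpha> iterations fail
  independently.\<close>

lemma prob_never_isolated:
  assumes V: "finite V" and p: "0 \<le> p" "p \<le> 1" and F: "F \<subseteq> V" and uv: "u \<in> V - F" "v \<in> V - F" "u \<noteq> v"
  shows "measure_pmf.prob (Pi_pmf V 0 (\<lambda>_. coin_code \<alpha> p))
      {\<rho>. \<forall>j<\<alpha>. \<not> (j \<in> set_decode (\<rho> u) \<and> j \<in> set_decode (\<rho> v) \<and> (\<forall>x\<in>F. j \<notin> set_decode (\<rho> x)))} =
    (1 - p\<^sup>2 * (1 - p) ^ card F) ^ \<alpha>"
proof -
  define N where "N = Pi_pmf V False (\<lambda>_. bernoulli_pmf p)"
  define good where "good = {h. h u \<and> h v \<and> (\<forall>x\<in>F. \<not> h x)}"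
  \<comment> \<open>This turns the event into a product event; unconstrained vertices contribute a
    factor 1.\<close>
  define B where "B x = (if x \<in> {u, v} then {True} else if x \<in> F then {False} else UNIV)" for x
  have finF: "finite F" using V F by (rule finite_subset[rotated])
  have "good = {h. \<forall>x\<in>V. h x \<in> B x}"
    using F uv by (auto simp: good_def B_def)
  then have "measure_pmf.prob N good = (\<Prod>x\<in>V. measure_pmf.prob (bernoulli_pmf p) (B x))"
    unfolding N_def by (simp add: prob_all_Pi_pmf[OF V])
  also have "\<dots> = (\<Prod>x\<in>{u, v} \<union> F. measure_pmf.prob (bernoulli_pmf p) (B x))"
    using V F uv by (intro prod.mono_neutral_right) (auto simp: B_def)
  also have "\<dots> = (\<Prod>x\<in>{u, v}. measure_pmf.prob (bernoulli_pmf p) (B x)) *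
      (\<Prod>x\<in>F. measure_pmf.prob (bernoulli_pmf p) (B x))"
    using uv finF by (intro prod.union_disjoint) auto
  also have "(\<Prod>x\<in>{u, v}. measure_pmf.prob (bernoulli_pmf p) (B x)) = p\<^sup>2"
    using uv p by (simp add: B_def prob_bernoulli_pmf power2_eq_square)
  also have "(\<Prod>x\<in>F. measure_pmf.prob (bernoulli_pmf p) (B x)) = (\<Prod>x\<in>F. 1 - p)"
    using uv p by (intro prod.cong) (auto simp: B_def prob_bernoulli_pmf)
  finally have good: "measure_pmf.prob N good = p\<^sup>2 * (1 - p) ^ card F" by simp
  have "measure_pmf.prob (Pi_pmf V 0 (\<lambda>_. coin_code \<alpha> p))
      {\<rho>. \<forall>j<\<alpha>. \<not> (j \<in> set_decode (\<rho> u) \<and> j \<in> set_decode (\<rho> v) \<and> (\<forall>x\<in>F. j \<notin> set_decode (\<rho> x)))} =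
    measure_pmf.prob (Pi_pmf {..<\<alpha>} (\<lambda>_. False) (\<lambda>_. N)) {g. \<forall>j\<in>{..<\<alpha>}. g j \<in> - good}"
    unfolding N_def good_def
    using prob_coin_code[OF V, of \<alpha> p "\<lambda>g. \<forall>j<\<alpha>. \<not> (g j u \<and> g j v \<and> (\<forall>x\<in>F. \<not> g j x))"]
    by (simp add: lessThan_def)
  also have "\<dots> = measure_pmf.prob N (- good) ^ \<alpha>"
    by (subst prob_all_Pi_pmf) auto
  also have "measure_pmf.prob N (- good) = 1 - p\<^sup>2 * (1 - p) ^ card F"
    using measure_pmf.prob_compl[of good N] good by (simp add: Compl_eq_Diff_UNIV)
  finally show ?thesis .
qed

text \<open>The activity pattern of iteration \<open>j\<close> is a marginal of the product, so the
  number of active vertices is binomial and Hoeffding's inequality applies.\<close>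

lemma prob_many_active:
  assumes V: "finite V" "V \<noteq> {}" and p: "0 \<le> p" "p \<le> 1" and j: "j < \<alpha>" and \<epsilon>: "\<epsilon> \<ge> 0"
  shows "measure_pmf.prob (Pi_pmf V 0 (\<lambda>_. coin_code \<alpha> p))
      {\<rho>. real (card {x \<in> V. j \<in> set_decode (\<rho> x)}) \<ge> real (card V) * p + \<epsilon>} \<le>
    exp (- 2 * \<epsilon>\<^sup>2 / real (card V))"
proof -
  define N where "N = Pi_pmf V False (\<lambda>_. bernoulli_pmf p)"
  have "measure_pmf.prob (Pi_pmf V 0 (\<lambda>_. coin_code \<alpha> p))
      {\<rho>. real (card {x \<in> V. j \<in> set_decode (\<rho> x)}) \<ge> real (card V) * p + \<epsilon>} =
    measure_pmf.prob (Pi_pmf {..<\<alpha>} (\<lambda>_. False) (\<lambda>_. N)) {g. real (card {x \<in> V. g j x}) \<ge> real (card V) * p + \<epsilon>}"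
    unfolding N_def
    using prob_coin_code[OF V(1), of \<alpha> p "\<lambda>g. real (card {x \<in> V. g j x}) \<ge> real (card V) * p + \<epsilon>"] by simp
  also have "\<dots> = measure_pmf.prob (map_pmf (\<lambda>g. g j) (Pi_pmf {..<\<alpha>} (\<lambda>_. False) (\<lambda>_. N)))
      {h. real (card {x \<in> V. h x}) \<ge> real (card V) * p + \<epsilon>}"
    by (simp add: vimage_def)
  also have "map_pmf (\<lambda>g. g j) (Pi_pmf {..<\<alpha>} (\<lambda>_. False) (\<lambda>_. N)) = N"
    using j by (subst Pi_pmf_component) auto
  also have "measure_pmf.prob N {h. real (card {x \<in> V. h x}) \<ge> real (card V) * p + \<epsilon>} =
      measure_pmf.prob (binomial_pmf (card V) p) {y. real y \<ge> real (card V) * p + \<epsilon>}"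
    unfolding N_def using V p by (subst binomial_pmf_altdef'[of V _ _ False]) (auto simp: vimage_def)
  also have "\<dots> \<le> exp (- 2 * \<epsilon>\<^sup>2 / real (card V))"
  proof (rule binomial_distribution.prob_ge)
    show "binomial_distribution p" using p by unfold_locales auto
    show "card V > 0" using V by (simp add: card_gt_0_iff)
  qed (rule \<epsilon>)
  finally show ?thesis .
qed

text \<open>A set of at most \<open>r\<close> vertices is listed and padded with \<open>None\<close>
  to a word of length \<open>r\<close> over an alphabet of \<open>Suc (card V)\<close>
  letters.\<close>

lemma card_small_subsets_le:
  assumes "finite V" shows "card {F. F \<subseteq> V \<and> card F \<le> r} \<le> Suc (card V) ^ r"
proof -
  let ?L = "{xs. set xs \<subseteq> insert None (Some ` V) \<and> length xs = r}"
  have finL: "finite ?L" using assms by (intro finite_lists_length_eq) auto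
  have "{F. F \<subseteq> V \<and> card F \<le> r} \<subseteq> (\<lambda>xs. {x. Some x \<in> set xs}) ` ?L"
  proof
    fix F assume "F \<in> {F. F \<subseteq> V \<and> card F \<le> r}"
    then have F: "F \<subseteq> V" "card F \<le> r" by auto
    then obtain ys where ys: "set ys = F" "distinct ys"
      using assms finite_distinct_list[of F] finite_subset by blast
    let ?xs = "map Some ys @ replicate (r - card F) None"
    have "length ?xs = r" using F ys distinct_card[of ys] by simp
    moreover have "set ?xs \<subseteq> insert None (Some ` V)" using F ys by auto
    moreover have "{x. Some x \<in> set ?xs} = F" using ys by auto
    ultimately show "F \<in> (\<lambda>xs. {x. Some x \<in> set xs}) ` ?L" by (intro image_eqI[of _ _ ?xs]) auto
  qed
  then have "card {F. F \<subseteq> V \<and> card F \<le> r} \<le> card ?L"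
    using finL by (rule surj_card_le[rotated])
  also have "\<dots> = card (insert None (Some ` V)) ^ r"
    using assms by (intro card_lists_length_eq) auto
  also have "card (insert None (Some ` V)) = Suc (card V)"
    using assms by (simp add: card_image)
  finally show ?thesis .
qed

section \<open>Calibrating the number of iterations\<close>

text \<open>A positive lower bound on the logarithm lets additive constants be absorbed into
  multiples of \<open>r ^ 3 * ln n\<close>.\<close>

lemma ln_real_ge_half:
  assumes "(2::nat) \<le> n" shows "1 / 2 \<le> ln (real n)"
proof -
  have "ln 2 \<le> ln (real n)" using assms by simp
  then show ?thesis using ln2_ge_two_thirds by linarith
qed

text \<open>The cap at \<open>n\<close> matters for \<open>r = 1\<close>, where
  \<open>2 * n / r\<close> exceeds \<open>n\<close>; it keeps the running time within
  \<open>t n\<close>.\<close>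

definition sample_size :: "nat \<Rightarrow> nat \<Rightarrow> nat" where
  "sample_size n r = min n (nat \<lceil>2 * real n / real r\<rceil>)"

lemma sample_size_bounds:
  assumes "1 \<le> r" "r \<le> n" "2 \<le> n"
  shows "2 \<le> sample_size n r" "real n \<le> real r * real (sample_size n r)"
proof -
  have "2 * real r \<le> 2 * real n" using assms by simp
  then have "2 \<le> 2 * real n / real r" using assms by (simp add: le_divide_eq)
  then have "2 \<le> nat \<lceil>2 * real n / real r\<rceil>" by linarith
  then show "2 \<le> sample_size n r" using assms by (simp add: sample_size_def)
  have "real n \<le> real r * real n" using assms by simp
  moreover have "real n \<le> real r * (2 * real n / real r)" using assms by simp
  moreover have "real r * (2 * real n / real r) \<le> real r * real (nat \<lceil>2 * real n / real r\<rceil>)"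
    by (intro mult_left_mono real_nat_ceiling_ge) auto
  ultimately show "real n \<le> real r * real (sample_size n r)"
    by (simp add: sample_size_def min_def)
qed

text \<open>When this bound applies, keeping every edge is sparse enough.\<close>

lemma square_le_edge_bound:
  assumes alg: "det_spanner_alg k f t T out" and k: "k \<ge> 0"
    and r: "1 \<le> r" "r \<le> n" and n: "2 \<le> n"
    and disj: "T (sample_size n r) = 0 \<or> real n < s * real r ^ 2 * ln (real n)"
    and c: "c \<ge> 10" "c \<ge> 2 * s" and s: "s \<ge> 0"
  shows "real n ^ 2 \<le> c * real r ^ 3 * ln (real n) * f (sample_size n r)"
proof -
  define m where "m = sample_size n r"
  define L where "L = ln (real n)"
  have m: "2 \<le> m" "real n \<le> real r * real m"
    using sample_size_bounds[OF r n] by (simp_all add: m_def)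
  have L: "1 / 2 \<le> L" using ln_real_ge_half[OF n] by (simp add: L_def)
  from disj show ?thesis
  proof
    assume "T (sample_size n r) = 0"
    then have "real (m div 2 * (m - m div 2)) \<le> f m"
      using det_spanner_alg_edges_ge_if_0_rounds[OF alg k] by (simp add: m_def)
    \<comment> \<open>The balanced split gives about a quarter of \<open>m * m\<close>; the constant
      5 instead of 4 pays for rounding when \<open>m\<close> is odd.\<close>
    moreover have "m * m \<le> 5 * (m div 2 * (m - m div 2))"
    proof -
      define b where "b = m div 2"
      have "b \<ge> 1" using m by (simp add: b_def)
      have b: "b \<le> b * b" using \<open>b \<ge> 1\<close> by simp
      have "m = 2 * b \<or> m = 2 * b + 1" unfolding b_def by presburger
      then show ?thesis
      proof
        assume "m = 2 * b"
        then show ?thesis by simp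
      next
        assume "m = 2 * b + 1"
        then show ?thesis using b \<open>b \<ge> 1\<close> by (simp add: algebra_simps)
      qed
    qed
    then have "real m ^ 2 \<le> 5 * real (m div 2 * (m - m div 2))"
      unfolding power2_eq_square by (metis of_nat_le_iff of_nat_mult of_nat_numeral)
    ultimately have f: "real m ^ 2 / 5 \<le> f m" by simp
    have "real n ^ 2 \<le> (real r * real m) ^ 2" using m by (intro power_mono) auto
    also have "\<dots> = real r ^ 2 * real m ^ 2" by (simp add: power_mult_distrib)
    also have "\<dots> \<le> real r ^ 3 * real m ^ 2"
      using r by (intro mult_right_mono power_increasing) auto
    \<comment> \<open>The 10 combines the 5 from the balanced split with
      \<open>L >= 1 / 2\<close>.\<close>
    also have "\<dots> = 10 * real r ^ 3 * (1 / 2) * (real m ^ 2 / 5)" by simp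
    also have "\<dots> \<le> c * real r ^ 3 * L * f m"
      using c L f by (intro mult_mono) auto
    finally show ?thesis by (simp add: m_def L_def)
  next
    assume n': "real n < s * real r ^ 2 * ln (real n)"
    have "real m / 2 \<le> real m - 1" using m by simp
    also have "\<dots> \<le> f m" by (rule det_spanner_alg_edges_ge[OF alg k])
    finally have f: "real m / 2 \<le> f m" .
    have "real n ^ 2 = real n * real n" by (simp add: power2_eq_square)
    \<comment> \<open>One factor \<open>n\<close> is bounded by the case assumption, the other by
      \<open>r * m\<close>; with \<open>m / 2 <= f m\<close> this asks for
      \<open>c >= 2 * s\<close>.\<close>
    also have "\<dots> \<le> (s * real r ^ 2 * L) * (real r * real m)"
      using n' m s L unfolding L_def[symmetric] by (intro mult_mono) auto
    also have "\<dots> = 2 * s * real r ^ 3 * L * (real m / 2)"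
      by (simp add: power2_eq_square power3_eq_cube)
    also have "\<dots> \<le> c * real r ^ 3 * L * f m"
      using c L f s by (intro mult_mono) auto
    finally show ?thesis by (simp add: m_def L_def)
  qed
qed

text \<open>The factor \<open>12 * r ^ 2\<close> offsets the success probability of one iteration.
  The rest makes a fixed triple \<open>F, u, v\<close> fail with probability at most
  \<open>n\<close> to the power \<open>-(2 * r + 3 + C)\<close>, enough for a union bound over
  \<open>n ^ (2 * r + 2)\<close> triples.\<close>

definition iterations :: "real \<Rightarrow> nat \<Rightarrow> nat \<Rightarrow> nat" where
  "iterations C n r = nat \<lceil>12 * real r ^ 2 * (2 * real r + 3 + C) * ln (real n)\<rceil>"

text \<open>The summand 2 in the constant pays for rounding up, because
  \<open>1 <= 2 * r ^ 3 * ln n\<close>.\<close>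

lemma iterations_le:
  assumes "C > 0" "1 \<le> r" "2 \<le> n"
  shows "real (iterations C n r) \<le> (12 * (5 + C) + 2) * real r ^ 3 * ln (real n)"
proof -
  have L: "1 / 2 \<le> ln (real n)" by (rule ln_real_ge_half) fact
  have r1: "1 \<le> real r" using assms by simp
  have "2 * real r + 3 + C \<le> (5 + C) * real r"
  proof -
    have "3 + C \<le> (3 + C) * real r" using r1 assms(1) by (intro mult_le_cancel_left1[THEN iffD2]) auto
    then show ?thesis by (simp add: algebra_simps)
  qed
  then have "12 * real r ^ 2 * (2 * real r + 3 + C) * ln (real n) \<le> 12 * real r ^ 2 * ((5 + C) * real r) * ln (real n)"
    using L by (intro mult_right_mono mult_left_mono) auto
  also have "\<dots> = 12 * (5 + C) * real r ^ 3 * ln (real n)"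
    by (simp add: power2_eq_square power3_eq_cube)
  finally have "12 * real r ^ 2 * (2 * real r + 3 + C) * ln (real n) \<le> 12 * (5 + C) * real r ^ 3 * ln (real n)" .
  moreover have "1 \<le> 2 * real r ^ 3 * ln (real n)"
  proof -
    have "1 * (1 / 2) \<le> real r ^ 3 * ln (real n)" using r1 L by (intro mult_mono) auto
    then show ?thesis by simp
  qed
  moreover have "real (iterations C n r) \<le> 12 * real r ^ 2 * (2 * real r + 3 + C) * ln (real n) + 1"
  proof -
    have "0 \<le> 12 * real r ^ 2 * (2 * real r + 3 + C) * ln (real n)"
      using L assms by (intro mult_nonneg_nonneg) auto
    then show ?thesis unfolding iterations_def by linarith
  qed
  ultimately show ?thesis by (simp add: algebra_simps)
qed

text \<open>Here \<open>(1 - p) ^ r\<close> is the reciprocal of \<open>(1 + 1 / r) ^ r\<close>,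
  hence at least \<open>1 / exp 1 >= 1 / 3\<close>, and \<open>p >= 1 / (2 * r)\<close>.\<close>

lemma isolation_prob_ge:
  assumes "1 \<le> r" "i \<le> r" and p: "p = 1 / (real r + 1)"
  shows "1 / (12 * real r ^ 2) \<le> p\<^sup>2 * (1 - p) ^ i"
proof -
  have r1: "1 \<le> real r" using assms by simp
  have p01: "0 \<le> p" "p \<le> 1" using r1 by (auto simp: p)
  have "(1 + 1 / real r) ^ r \<le> exp (1 / real r) ^ r"
    using r1 by (intro power_mono) auto
  also have "\<dots> = exp 1" using r1 by (simp add: exp_of_nat_mult[symmetric])
  also have "\<dots> \<le> 3" by (rule exp_le)
  finally have "1 / 3 \<le> 1 / (1 + 1 / real r) ^ r"
    by (intro divide_left_mono) (auto intro!: zero_less_power add_pos_nonneg)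
  also have "\<dots> = (1 - p) ^ r"
    using r1 by (simp add: p power_one_over[symmetric] field_simps)
  also have "\<dots> \<le> (1 - p) ^ i"
    using p01 assms by (intro power_decreasing) auto
  finally have third: "1 / 3 \<le> (1 - p) ^ i" .
  have "1 / (4 * real r ^ 2) = (1 / (2 * real r))\<^sup>2" by (simp add: power_divide power_mult_distrib)
  also have "\<dots> \<le> p\<^sup>2"
    unfolding p using r1 by (intro power_mono divide_left_mono) auto
  finally have "1 / (4 * real r ^ 2) * (1 / 3) \<le> p\<^sup>2 * (1 - p) ^ i"
    using third by (intro mult_mono) auto
  then show ?thesis by simp
qed

text \<open>There are two ways to fail, an oversized sample and a triple \<open>F, u, v\<close> that
  is never separated. Each has total probability at most \<open>n\<close> to the power
  \<open>-(1 + C)\<close>; \<open>s\<close> is chosen so that the Hoeffding bound survives the sum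
  over all iterations.\<close>

lemma prob_sampling_success:
  assumes C: "C > 0" and V: "finite V" "card V = n" and r: "1 \<le> r" "r \<le> n" and n: "2 \<le> n"
    and K: "K = 12 * (5 + C) + 2" and s: "s = (2 * K + C + 5) / 2"
    and large: "s * real r ^ 2 * ln (real n) \<le> real n"
  shows "1 - 1 / real n powr C \<le>
    measure_pmf.prob (Pi_pmf V 0 (\<lambda>_. coin_code (iterations C n r) (1 / (real r + 1))))
      {\<rho>. (\<forall>j<iterations C n r. card {x \<in> V. j \<in> set_decode (\<rho> x)} \<le> sample_size n r) \<and>
         (\<forall>F u v. F \<subseteq> V \<longrightarrow> card F \<le> r \<longrightarrow> u \<in> V - F \<longrightarrow> v \<in> V - F \<longrightarrow> u \<noteq> v \<longrightarrow>
           (\<exists>j<iterations C n r. j \<in> set_decode (\<rho> u) \<and> j \<in> set_decode (\<rho> v) \<and>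
             (\<forall>x\<in>F. j \<notin> set_decode (\<rho> x))))}"
    (is "_ \<le> measure_pmf.prob ?M ?good")
proof -
  define \<alpha> where "\<alpha> = iterations C n r"
  define p where "p = 1 / (real r + 1)"
  define L where "L = ln (real n)"
  define M where "M = Pi_pmf V 0 (\<lambda>_. coin_code \<alpha> p)"
  have L: "1 / 2 \<le> L" using ln_real_ge_half[OF n] by (simp add: L_def)
  have r1: "1 \<le> real r" using r by simp
  have n0: "real n > 0" using n by simp
  have p01: "0 \<le> p" "p \<le> 1" using r1 by (auto simp: p_def)
  have exp_L: "exp (x * L) = real n powr x" for x
    using n0 by (simp add: powr_def L_def)
  have exp_n: "exp (real i * L) = real n ^ i" for i
    unfolding exp_L using n0 by (rule powr_realpow)
  \<comment> \<open>Two such budgets fit into \<open>1 / n powr C\<close> because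
    \<open>n >= 2\<close>.\<close>
  define budget where "budget = exp (- (1 + C) * L)"

  \<comment> \<open>The mean is \<open>n / (r + 1)\<close>, so staying below a deviation of
    \<open>n / r\<close> keeps the sample under \<open>2 * n / r\<close>.\<close>
  define big where "big j = {\<rho> :: 'a \<Rightarrow> nat. real (card {x \<in> V. j \<in> set_decode (\<rho> x)}) \<ge> real (card V) * p + real n / real r}" for j
  have "measure_pmf.prob M (\<Union>j<\<alpha>. big j) \<le> (\<Sum>j<\<alpha>. measure_pmf.prob M (big j))"
    by (rule measure_pmf.finite_measure_subadditive_finite) auto
  also have "\<dots> \<le> (\<Sum>j<\<alpha>. exp (- (2 * s * L)))"
  proof (rule sum_mono)
    fix j assume "j \<in> {..<\<alpha>}"
    then have "measure_pmf.prob M (big j) \<le> exp (- 2 * (real n / real r)\<^sup>2 / real (card V))"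
      unfolding M_def big_def using V n p01 by (intro prob_many_active) auto
    also have "\<dots> = exp (- (2 * (real n / real r ^ 2)))"
      using n0 V by (simp add: power2_eq_square)
    also have "\<dots> \<le> exp (- (2 * s * L))"
      using large r1 by (simp add: L_def le_divide_eq mult.commute mult.left_commute)
    finally show "measure_pmf.prob M (big j) \<le> exp (- (2 * s * L))" .
  qed
  also have "\<dots> = real \<alpha> * exp (- (2 * s * L))" by simp
  also have "\<dots> \<le> budget"
  proof -
    have "real \<alpha> \<le> K * real r ^ 3 * L"
      unfolding \<alpha>_def K L_def by (rule iterations_le) fact+
    \<comment> \<open>A crude bound of \<alpha> by a power of \<open>n\<close> with exponent
      \<open>2 * K + 4\<close>. As \<open>2 * s = 2 * K + C + 5\<close>, exactly
      \<open>-(1 + C)\<close> remains in the exponent.\<close>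
    also have "\<dots> \<le> exp (2 * K * L) * real n ^ 3 * real n"
    proof (intro mult_mono)
      have "K \<le> exp K" using exp_ge_add_one_self[of K] by linarith
      also have "\<dots> \<le> exp (2 * K * L)"
      proof -
        have "K \<ge> 0" using C by (simp add: K)
        then have "2 * K * (1 / 2) \<le> 2 * K * L" using L by (intro mult_left_mono) auto
        then show ?thesis by simp
      qed
      finally show "K \<le> exp (2 * K * L)" .
      show "L \<le> real n" unfolding L_def using n0 by (rule ln_bound)
    qed (use r L C in \<open>auto simp: K intro!: power_mono\<close>)
    also have "\<dots> = exp (2 * K * L) * exp (real 4 * L)"
      unfolding exp_n by (simp add: power_numeral_reduce)
    finally have "real \<alpha> * exp (- (2 * s * L)) \<le> exp (2 * K * L) * exp (real 4 * L) * exp (- (2 * s * L))"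
      by (intro mult_right_mono) auto
    also have "\<dots> = budget"
      unfolding budget_def s by (simp add: exp_add[symmetric] algebra_simps)
    finally show ?thesis .
  qed
  finally have prob_big: "measure_pmf.prob M (\<Union>j<\<alpha>. big j) \<le> budget" .

  define \<F> where "\<F> = {F. F \<subseteq> V \<and> card F \<le> r}"
  define I where "I = {(F, u, v). F \<in> \<F> \<and> u \<in> V - F \<and> v \<in> V - F \<and> u \<noteq> v}"
  define missed where "missed = (\<lambda>(F, u, v). {\<rho> :: 'a \<Rightarrow> nat. \<forall>j<\<alpha>. \<not> (j \<in> set_decode (\<rho> u) \<and> j \<in> set_decode (\<rho> v) \<and>
             (\<forall>x\<in>F. j \<notin> set_decode (\<rho> x)))})"
  have fin\<F>: "finite \<F>" unfolding \<F>_def using V by (intro finite_subset[OF _ finite_Pow_iff[THEN iffD2, of V]]) auto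
  have I: "I \<subseteq> \<F> \<times> V \<times> V" by (auto simp: I_def)
  have finI: "finite I" using I by (rule finite_subset) (use fin\<F> V in auto)
  \<comment> \<open>There are at most \<open>(n + 1) ^ r\<close> fault sets and \<open>n ^ 2\<close>
    pairs, and \<open>n + 1 <= n ^ 2\<close>.\<close>
  have cardI: "real (card I) \<le> exp ((2 * real r + 2) * L)"
  proof -
    have "card I \<le> card (\<F> \<times> V \<times> V)" using I by (intro card_mono) (use fin\<F> V in auto)
    also have "\<dots> = card \<F> * n ^ 2" using V by (simp add: card_cartesian_product power2_eq_square)
    also have "\<dots> \<le> Suc n ^ r * n ^ 2"
      using card_small_subsets_le[OF V(1), of r] V by (intro mult_right_mono) (auto simp: \<F>_def)
    also have "\<dots> \<le> (n ^ 2) ^ r * n ^ 2"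
    proof -
      have "2 * n \<le> n * n" using n by simp
      then have "Suc n \<le> n ^ 2" using n unfolding power2_eq_square by linarith
      then show ?thesis by (intro mult_right_mono power_mono) auto
    qed
    also have "\<dots> = n ^ (2 * r + 2)" unfolding power_add power_mult ..
    finally have "real (card I) \<le> real n ^ (2 * r + 2)" by (metis of_nat_le_iff of_nat_power)
    also have "\<dots> = exp ((2 * real r + 2) * L)" unfolding exp_n[symmetric] by simp
    finally show ?thesis .
  qed
  have "measure_pmf.prob M (\<Union>i\<in>I. missed i) \<le> (\<Sum>i\<in>I. measure_pmf.prob M (missed i))"
    by (rule measure_pmf.finite_measure_subadditive_finite) (use finI in auto)
  also have "\<dots> \<le> (\<Sum>i\<in>I. exp (- (2 * real r + 3 + C) * L))"
  proof (rule sum_mono, clarify)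
    fix F u v assume "(F, u, v) \<in> I"
    then have i: "F \<subseteq> V" "card F \<le> r" "u \<in> V - F" "v \<in> V - F" "u \<noteq> v"
      by (auto simp: I_def \<F>_def)
    define q where "q = p\<^sup>2 * (1 - p) ^ card F"
    have q: "1 / (12 * real r ^ 2) \<le> q"
      unfolding q_def using isolation_prob_ge[OF r(1) i(2) p_def] .
    have q1: "q \<le> 1" unfolding q_def using p01 by (intro mult_le_one power_le_one) auto
    have "measure_pmf.prob M (missed (F, u, v)) = (1 - q) ^ \<alpha>"
      unfolding M_def missed_def prod.case q_def by (rule prob_never_isolated) (use V p01 i in auto)
    also have "\<dots> \<le> exp (- q) ^ \<alpha>"
      using q1 exp_ge_add_one_self[of "- q"] by (intro power_mono) auto
    also have "\<dots> = exp (- (q * real \<alpha>))" by (simp add: exp_of_nat_mult[symmetric] mult.commute)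
    also have "\<dots> \<le> exp (- ((2 * real r + 3 + C) * L))"
    proof -
      have "(2 * real r + 3 + C) * L = 1 / (12 * real r ^ 2) * (12 * real r ^ 2 * (2 * real r + 3 + C) * L)"
        using r1 by simp
      also have "\<dots> \<le> q * real \<alpha>"
      proof (intro mult_mono q)
        show "12 * real r ^ 2 * (2 * real r + 3 + C) * L \<le> real \<alpha>"
          unfolding \<alpha>_def iterations_def L_def by (rule real_nat_ceiling_ge)
        show "0 \<le> q" using p01 by (simp add: q_def)
      qed (use L C in auto)
      finally show ?thesis by simp
    qed
    finally show "measure_pmf.prob M (missed (F, u, v)) \<le> exp (- (2 * real r + 3 + C) * L)"
      by (simp only: minus_mult_left)
  qed
  also have "\<dots> = real (card I) * exp (- (2 * real r + 3 + C) * L)" by simp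
  also have "\<dots> \<le> exp ((2 * real r + 2) * L) * exp (- (2 * real r + 3 + C) * L)"
    using cardI by (intro mult_right_mono) auto
  also have "\<dots> = budget" unfolding budget_def by (simp add: exp_add[symmetric] algebra_simps)
  finally have prob_missed: "measure_pmf.prob M (\<Union>i\<in>I. missed i) \<le> budget" .

  have "2 * budget \<le> 1 / real n powr C"
  proof -
    have "budget = 1 / real n * (1 / real n powr C)"
      unfolding budget_def exp_L using n0 by (simp add: powr_add[symmetric] powr_minus_divide powr_diff)
    also have "\<dots> \<le> 1 / 2 * (1 / real n powr C)"
      using n by (intro mult_right_mono) auto
    finally show ?thesis by simp
  qed
  then have "1 - 1 / real n powr C \<le> 1 - measure_pmf.prob M ((\<Union>j<\<alpha>. big j) \<union> (\<Union>i\<in>I. missed i))"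
    using prob_big prob_missed measure_Un_le[of "\<Union>j<\<alpha>. big j" M "\<Union>i\<in>I. missed i"] by simp
  also have "\<dots> = measure_pmf.prob M (- ((\<Union>j<\<alpha>. big j) \<union> (\<Union>i\<in>I. missed i)))"
    using measure_pmf.prob_compl[of "(\<Union>j<\<alpha>. big j) \<union> (\<Union>i\<in>I. missed i)" M]
    by (simp add: Compl_eq_Diff_UNIV)
  also have "\<dots> \<le> measure_pmf.prob M ?good"
  proof (intro measure_pmf.finite_measure_mono subsetI)
    fix \<rho> :: "'a \<Rightarrow> nat"
    assume \<rho>: "\<rho> \<in> - ((\<Union>j<\<alpha>. big j) \<union> (\<Union>i\<in>I. missed i))"
    have "card {x \<in> V. j \<in> set_decode (\<rho> x)} \<le> sample_size n r" if "j < \<alpha>" for j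
    proof -
      have "real (card {x \<in> V. j \<in> set_decode (\<rho> x)}) < real n * p + real n / real r"
        using \<rho> that V by (auto simp: big_def not_le)
      also have "\<dots> \<le> real n / real r + real n / real r"
      proof -
        have "real n / (real r + 1) \<le> real n / real r" using r1 by (intro divide_left_mono) auto
        then show ?thesis by (simp add: p_def)
      qed
      finally have "real (card {x \<in> V. j \<in> set_decode (\<rho> x)}) < 2 * real n / real r" by simp
      then have "card {x \<in> V. j \<in> set_decode (\<rho> x)} \<le> nat \<lceil>2 * real n / real r\<rceil>" by linarith
      moreover have "card {x \<in> V. j \<in> set_decode (\<rho> x)} \<le> n"
        using V by (auto intro!: card_mono)
      ultimately show ?thesis by (simp add: sample_size_def)
    qed
    moreover have "\<exists>j<\<alpha>. j \<in> set_decode (\<rho> u) \<and> j \<in> set_decode (\<rho> v) \<and> (\<forall>x\<in>F. j \<notin> set_decode (\<rho> x))"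
      if "F \<subseteq> V" "card F \<le> r" "u \<in> V - F" "v \<in> V - F" "u \<noteq> v" for F u v
    proof -
      have "(F, u, v) \<in> I" using that by (auto simp: I_def \<F>_def)
      then have "\<rho> \<notin> missed (F, u, v)" using \<rho> by blast
      then show ?thesis by (auto simp: missed_def)
    qed
    ultimately show "\<rho> \<in> ?good" unfolding \<alpha>_def by blast
  qed simp
  finally show ?thesis by (simp add: M_def \<alpha>_def p_def)
qed

section \<open>The fault-tolerant algorithm\<close>

lemma active_edges_eq: "active_edges a \<rho> E = {e \<in> E. e \<subseteq> {x. a (\<rho> x)}}"
  by (auto simp: active_edges_def)

lemma local_output_UNIV:
  assumes "wgraph V E w" "\<And>v. out (know E w n r \<rho> T v) = UNIV"
  shows "local_output E w n r \<rho> T out = E"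
  using assms by (auto simp: local_output_def wgraph_def)

text \<open>Isolated vertices pad every active subgraph to exactly \<open>m\<close> vertices, so that the simulated
algorithm can be told the vertex count although no node knows how many vertices are active.\<close>

lemma padded_spanner:
  assumes alg: "det_spanner_alg k f t T out" and G: "wgraph V E w"
    and le: "card {x \<in> V. a (\<rho> x)} \<le> m"
  shows "\<exists>W. V \<inter> {x. a (\<rho> x)} \<subseteq> W \<and>
      is_spanner W {e \<in> E. e \<subseteq> {x. a (\<rho> x)}} w k (local_output (active_edges a \<rho> E) w m 0 (\<lambda>_. 0) (T m) out)"
    "real (card (local_output (active_edges a \<rho> E) w m 0 (\<lambda>_. 0) (T m) out)) \<le> f m"
proof -
  let ?A = "{x \<in> V. a (\<rho> x)}"
  have fin: "finite ?A" using G by (simp add: wgraph_def)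
  \<comment> \<open>The padding only has to avoid active vertices; it may reuse inactive ones, since
    no active edge touches them.\<close>
  obtain B where B: "finite B" "card B = m - card ?A" "?A \<inter> B = {}"
    using finite_arbitrarily_large_disj[OF infinite_UNIV_nat fin] by blast
  have "wgraph (?A \<union> B) (active_edges a \<rho> E) w"
    using G fin B unfolding wgraph_def active_edges_def
    by simp (metis doubleton_eq_iff insertCI)
  moreover have "card (?A \<union> B) = m" using fin B le by (simp add: card_Un_disjoint)
  ultimately have "is_spanner (?A \<union> B) (active_edges a \<rho> E) w k
      (local_output (active_edges a \<rho> E) w m 0 (\<lambda>_. 0) (T m) out)"
    and card: "real (card (local_output (active_edges a \<rho> E) w m 0 (\<lambda>_. 0) (T m) out)) \<le> f m"
    using det_spanner_algD(2,3)[OF alg] by blast+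
  then show "\<exists>W. V \<inter> {x. a (\<rho> x)} \<subseteq> W \<and>
      is_spanner W {e \<in> E. e \<subseteq> {x. a (\<rho> x)}} w k (local_output (active_edges a \<rho> E) w m 0 (\<lambda>_. 0) (T m) out)"
    unfolding active_edges_eq by (intro exI[of _ "?A \<union> B"]) auto
  show "real (card (local_output (active_edges a \<rho> E) w m 0 (\<lambda>_. 0) (T m) out)) \<le> f m" by (rule card)
qed

text \<open>The deterministic half of the argument: for a fixed outcome \<rho>, small samples and
  separation of every triple already make the union correct and sparse.\<close>

lemma simulated_ft_spanner:
  assumes alg: "det_spanner_alg k f t T out" and G: "wgraph V E w" and k: "k > 0"
    and out': "\<And>v. out' (know E w n r \<rho> (Suc (T m)) v) =
      simulate_out \<alpha> (\<lambda>j x. j \<in> set_decode x) m (T m) out (know E w n r \<rho> (Suc (T m)) v)"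
    and small: "\<And>j. j < \<alpha> \<Longrightarrow> card {x \<in> V. j \<in> set_decode (\<rho> x)} \<le> m"
    and hit: "\<And>F u v. F \<subseteq> V \<Longrightarrow> card F \<le> r \<Longrightarrow> u \<in> V - F \<Longrightarrow> v \<in> V - F \<Longrightarrow> u \<noteq> v \<Longrightarrow>
       \<exists>j<\<alpha>. j \<in> set_decode (\<rho> u) \<and> j \<in> set_decode (\<rho> v) \<and> (\<forall>x\<in>F. j \<notin> set_decode (\<rho> x))"
  shows "is_ft_spanner V E w r k (local_output E w n r \<rho> (Suc (T m)) out')"
    "real (card (local_output E w n r \<rho> (Suc (T m)) out')) \<le> real \<alpha> * f m"
proof -
  define S where "S j = {x. j \<in> set_decode (\<rho> x)}" for j
  define H where "H j = local_output (active_edges (\<lambda>x. j \<in> set_decode x) \<rho> E) w m 0 (\<lambda>_. 0) (T m) out" for j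
  have finE: "finite E" by (rule wgraph_finite_edges[OF G])
  have out_eq: "local_output E w n r \<rho> (Suc (T m)) out' = (\<Union>j<\<alpha>. H j)"
    unfolding H_def using G by (intro local_output_simulate_out finE out') (simp add: wgraph_def, blast)
  have "\<exists>W. V \<inter> S j \<subseteq> W \<and> is_spanner W {e \<in> E. e \<subseteq> S j} w k (H j)" if "j < \<alpha>" for j
    unfolding S_def H_def using padded_spanner(1)[OF alg G, where a = "\<lambda>x. j \<in> set_decode x" and \<rho> = \<rho>] small[OF that] by simp
  then obtain W where W: "\<And>j. j < \<alpha> \<Longrightarrow> V \<inter> S j \<subseteq> W j"
    "\<And>j. j < \<alpha> \<Longrightarrow> is_spanner (W j) {e \<in> E. e \<subseteq> S j} w k (H j)"
    by metis
  show "is_ft_spanner V E w r k (local_output E w n r \<rho> (Suc (T m)) out')"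
    unfolding out_eq
  proof (rule is_ft_spanner_UN[OF G k W(2,1)])
    fix F u v assume "F \<subseteq> V" "card F \<le> r" "u \<in> V - F" "v \<in> V - F" "u \<noteq> v"
    then show "\<exists>j<\<alpha>. u \<in> S j \<and> v \<in> S j \<and> S j \<inter> F = {}"
      using hit[of F u v] by (auto simp: S_def)
  qed
  have "real (card (\<Union>j<\<alpha>. H j)) \<le> (\<Sum>j<\<alpha>. real (card (H j)))"
    using card_UN_le[of "{..<\<alpha>}" H] by (simp flip: of_nat_sum)
  also have "\<dots> \<le> (\<Sum>j<\<alpha>. f m)"
    unfolding H_def by (intro sum_mono padded_spanner(2)[OF alg G] small) auto
  finally show "real (card (local_output E w n r \<rho> (Suc (T m)) out')) \<le> real \<alpha> * f m"
    unfolding out_eq by simp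
qed

text \<open>The constant \<open>c\<close> depends on \<open>C\<close> alone, uniformly in
  \<open>k\<close>, \<open>f\<close> and \<open>t\<close>. Monotonicity transfers bounds at the
  sample size to \<open>2 * n / r\<close> rounded up for \<open>f\<close>, and to \<open>n\<close>
  for \<open>t\<close>.\<close>

theorem theorem2p3:
  fixes C :: real
  assumes "C > 0"
  shows "\<exists>c>0. \<forall>(k::real) (f::nat \<Rightarrow> real) (t::nat \<Rightarrow> real).
    k \<ge> 1 \<longrightarrow> (\<forall>n. f n \<ge> 0) \<longrightarrow> (\<forall>n. t n \<ge> 0) \<longrightarrow> mono f \<longrightarrow> mono t \<longrightarrow>
    (\<exists>TA outA. det_spanner_alg k f t TA outA) \<longrightarrow>
    (\<exists>(TB :: nat \<Rightarrow> nat \<Rightarrow> nat) (D :: nat \<Rightarrow> nat \<Rightarrow> nat pmf) (outB :: lstate \<Rightarrow> nat set set).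
       \<forall>V E w (r::nat). wgraph V E w \<longrightarrow> 1 \<le> r \<longrightarrow> r \<le> card V \<longrightarrow>
         (let n = card V in
            real (TB n r) \<le> c * real r ^ 3 * ln (real n) * t n \<and>
            measure_pmf.prob (Pi_pmf V 0 (\<lambda>_. D n r))
              (ft_success V E w r k
                 (c * real r ^ 3 * ln (real n) * f (nat \<lceil>2 * real n / real r\<rceil>)) (TB n r) outB)
              \<ge> 1 - 1 / real n powr C))"
proof -
  \<comment> \<open>\<open>K\<close> bounds the iterations, \<open>s\<close> is the threshold for
    Hoeffding, and \<open>c\<close> dominates what sampling (\<open>K\<close>) and keeping all edges
    (10 and \<open>2 * s\<close>) require.\<close>
  define K where "K = 12 * (5 + C) + 2"
  define s where "s = (2 * K + C + 5) / 2"
  define c where "c = 10 + 2 * s + K"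
  have K: "K \<ge> 0" and s: "s \<ge> 0" using assms by (auto simp: K_def s_def)
  then have c: "c \<ge> 10" "c \<ge> 2 * s" "c \<ge> K" by (auto simp: c_def)
  show ?thesis
  proof (intro exI[of _ c] conjI allI impI)
    show "c > 0" using c by simp
    fix k :: real and f t :: "nat \<Rightarrow> real"
    assume k: "k \<ge> 1" and f: "\<forall>n. f n \<ge> 0" and t: "\<forall>n. t n \<ge> 0" and mono: "mono f" "mono t"
    assume "\<exists>TA outA. det_spanner_alg k f t TA outA"
    then obtain T out where alg: "det_spanner_alg k f t T out" by blast
    \<comment> \<open>The choice depends on \<open>n\<close> and \<open>r\<close> only, so all nodes
      make it alike without communication.\<close>
    define keep_all where "keep_all n r \<longleftrightarrow> n < 2 \<or> T (sample_size n r) = 0 \<or>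
      real n < s * real r ^ 2 * ln (real n)" for n r
    define TB where "TB n r = (if keep_all n r then 0 else Suc (T (sample_size n r)))" for n r
    define D where "D n r = coin_code (iterations C n r) (1 / (real r + 1))" for n r
    define outB where "outB st = (let n = known_n st; r = known_r st; m = sample_size n r in
      if keep_all n r then UNIV
      else simulate_out (iterations C n r) (\<lambda>j x. j \<in> set_decode x) m (T m) out st)" for st
    show "\<exists>(TB :: nat \<Rightarrow> nat \<Rightarrow> nat) (D :: nat \<Rightarrow> nat \<Rightarrow> nat pmf) (outB :: lstate \<Rightarrow> nat set set).
       \<forall>V E w (r::nat). wgraph V E w \<longrightarrow> 1 \<le> r \<longrightarrow> r \<le> card V \<longrightarrow>
         (let n = card V in
            real (TB n r) \<le> c * real r ^ 3 * ln (real n) * t n \<and>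
            measure_pmf.prob (Pi_pmf V 0 (\<lambda>_. D n r))
              (ft_success V E w r k
                 (c * real r ^ 3 * ln (real n) * f (nat \<lceil>2 * real n / real r\<rceil>)) (TB n r) outB)
              \<ge> 1 - 1 / real n powr C)"
    proof (intro exI[of _ TB] exI[of _ D] exI[of _ outB] allI impI)
      fix V E w and r :: nat
      assume G: "wgraph V E w" and r: "1 \<le> r" "r \<le> card V"
      define n where "n = card V"
      define m where "m = sample_size n r"
      define bound where "bound = c * real r ^ 3 * ln (real n) * f (nat \<lceil>2 * real n / real r\<rceil>)"
      have V: "finite V" using G by (simp add: wgraph_def)
      have rn: "r \<le> n" using r by (simp add: n_def)
      have factor: "0 \<le> c * real r ^ 3 * ln (real n)"
        using c r rn by (intro mult_nonneg_nonneg) auto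
      have bound: "c * real r ^ 3 * ln (real n) * f m \<le> bound"
        unfolding bound_def m_def sample_size_def using factor mono(1)
        by (intro mult_left_mono) (auto intro: monoD)
      have rounds: "real (TB n r) \<le> c * real r ^ 3 * ln (real n) * t n"
      proof (cases "keep_all n r")
        case True
        then show ?thesis using factor t by (simp add: TB_def)
      next
        case False
        then have "2 \<le> n" "T m \<ge> 1" by (auto simp: keep_all_def m_def)
        then have "1 * (1 / 2) \<le> real r ^ 3 * ln (real n)"
          using ln_real_ge_half[of n] r by (intro mult_mono) auto
        \<comment> \<open>As \<open>T m\<close> is positive, the extra round at most doubles the
          cost; this absorbs the factor 2.\<close>
        then have two: "2 \<le> c * real r ^ 3 * ln (real n)"
          using mult_mono[of 10 c "1 / 2" "real r ^ 3 * ln (real n)"] c by (simp add: mult.assoc)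
        have "real (TB n r) \<le> 2 * real (T m)"
          using False \<open>T m \<ge> 1\<close> by (simp add: TB_def m_def)
        also have "\<dots> \<le> 2 * t m" using det_spanner_alg_rounds[OF alg] by simp
        also have "\<dots> \<le> 2 * t n" using mono(2) by (simp add: monoD m_def sample_size_def)
        also have "\<dots> \<le> c * real r ^ 3 * ln (real n) * t n" using two t by (intro mult_right_mono) auto
        finally show ?thesis .
      qed
      have prob: "1 - 1 / real n powr C \<le>
        measure_pmf.prob (Pi_pmf V 0 (\<lambda>_. D n r)) (ft_success V E w r k bound (TB n r) outB)"
      proof (cases "n < 2")
        case True
        \<comment> \<open>For a single vertex the required probability is 0.\<close>
        then have "n = 1" using r rn by simp
        then show ?thesis by simp
      next
        case False
        then have n: "2 \<le> n" by simp
        show ?thesis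
        proof (cases "keep_all n r")
          case True
          have all: "local_output E w n r \<rho> (TB n r) outB = E" for \<rho>
            using True by (intro local_output_UNIV[OF G]) (simp add: outB_def)
          have "real (card E) \<le> real n ^ 2"
            using wgraph_card_edges_le[OF G] unfolding n_def power2_eq_square
            by (metis of_nat_le_iff of_nat_mult)
          also have "\<dots> \<le> c * real r ^ 3 * ln (real n) * f m"
            unfolding m_def using True n k
            by (intro square_le_edge_bound[OF alg _ r(1) rn n _ c(1,2) s]) (auto simp: keep_all_def)
          also note bound
          finally have "ft_success V E w r k bound (TB n r) outB = UNIV"
            using is_ft_spanner_self[OF G k] by (simp add: ft_success_def n_def[symmetric] all)
          then show ?thesis using n by simp
        next
          case False
          then have large: "s * real r ^ 2 * ln (real n) \<le> real n" by (simp add: keep_all_def)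
          have TB: "TB n r = Suc (T m)" using False by (simp add: TB_def m_def)
          have out: "outB (know E w n r \<rho> (Suc (T m)) v) =
              simulate_out (iterations C n r) (\<lambda>j x. j \<in> set_decode x) m (T m) out (know E w n r \<rho> (Suc (T m)) v)" for \<rho> v
            using False by (simp add: outB_def m_def Let_def del: know.simps)
          have "1 - 1 / real n powr C \<le> measure_pmf.prob (Pi_pmf V 0 (\<lambda>_. D n r))
              {\<rho>. (\<forall>j<iterations C n r. card {x \<in> V. j \<in> set_decode (\<rho> x)} \<le> sample_size n r) \<and>
                 (\<forall>F u v. F \<subseteq> V \<longrightarrow> card F \<le> r \<longrightarrow> u \<in> V - F \<longrightarrow> v \<in> V - F \<longrightarrow> u \<noteq> v \<longrightarrow>
                   (\<exists>j<iterations C n r. j \<in> set_decode (\<rho> u) \<and> j \<in> set_decode (\<rho> v) \<and>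
                     (\<forall>x\<in>F. j \<notin> set_decode (\<rho> x))))}"
            (is "_ \<le> measure_pmf.prob _ ?good")
            unfolding D_def
            by (rule prob_sampling_success[OF assms V n_def[symmetric] r(1) rn n K_def s_def large])
          also have "\<dots> \<le> measure_pmf.prob (Pi_pmf V 0 (\<lambda>_. D n r)) (ft_success V E w r k bound (TB n r) outB)"
          proof (intro measure_pmf.finite_measure_mono subsetI)
            fix \<rho> assume \<rho>: "\<rho> \<in> ?good"
            have "is_ft_spanner V E w r k (local_output E w n r \<rho> (Suc (T m)) outB)"
              and "real (card (local_output E w n r \<rho> (Suc (T m)) outB)) \<le> real (iterations C n r) * f m"
              using simulated_ft_spanner[OF alg G _ out, where \<rho> = \<rho>] \<rho> k unfolding m_def by simp_all
            moreover have "real (iterations C n r) * f m \<le> c * real r ^ 3 * ln (real n) * f m"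
            proof (rule mult_right_mono)
              have "real (iterations C n r) \<le> K * (real r ^ 3 * ln (real n))"
                using iterations_le[OF assms r(1) n] by (simp add: K_def mult.assoc)
              also have "\<dots> \<le> c * (real r ^ 3 * ln (real n))"
                using c n by (intro mult_right_mono) auto
              finally show "real (iterations C n r) \<le> c * real r ^ 3 * ln (real n)"
                by (simp add: mult.assoc)
            qed (use f in auto)
            ultimately show "\<rho> \<in> ft_success V E w r k bound (TB n r) outB"
              using bound by (simp add: ft_success_def n_def[symmetric] TB del: know.simps)
          qed simp
          finally show ?thesis .
        qed
      qed
      show "let n = card V in
            real (TB n r) \<le> c * real r ^ 3 * ln (real n) * t n \<and>
            measure_pmf.prob (Pi_pmf V 0 (\<lambda>_. D n r))
              (ft_success V E w r k
                 (c * real r ^ 3 * ln (real n) * f (nat \<lceil>2 * real n / real r\<rceil>)) (TB n r) outB)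
              \<ge> 1 - 1 / real n powr C"
        using rounds prob unfolding Let_def n_def bound_def by blast
    qed
  qed
qed

end
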